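(* The axiom system $\mathsf{EL}_{\mathsf{int}}$ is a sound and complete axiomatization of the language $\mathcal{EL}_{\mathsf{int}}$ with respect to topological subset models; that is, for every formula $\phi \in \mathcal{EL}_{\mathsf{int}}$, $\phi$ is a theorem of $\mathsf{EL}_{\mathsf{int}}$ if and only if $\phi$ is valid, i.e. $(\mathcal{X},x,U) \models \phi$ for every topological subset model $\mathcal{X}$ and every epistemic scenario $(x,U)$ of $\mathcal{X}$.
   Context: Let $\mathrm{PROP}$ be a countable set of primitive propositions. The language $\mathcal{EL}_{\mathsf{int}}$ is recursively generated by the grammar $\phi ::= p \mid \lnot\phi \mid \phi\land\psi \mid K\phi \mid \mathsf{int}(\phi)$, with $p \in \mathrm{PROP}$; other Boolean connectives are the usual abbreviations (in particular $\phi\rightarrow\psi$ is $\lnot(\phi\land\lnot\psi)$). A topological subset model is a triple $\mathcal{X}=(X,\mathcal{T},v)$ where $X$ is a nonempty set, $\mathcal{T}$ is a topology on $X$, and $v:\mathrm{PROP}\to 2^X$. An epistemic scenario of $\mathcal{X}$ is a pair $(x,U)$ with $x\in U\in\mathcal{T}$. Truth at epistemic scenarios is defined by: - $(\mathcal{X},x,U)\models p$ iff $x\in v(p)$; - $(\mathcal{X},x,U)\models\lnot\phi$ iff $(\mathcal{X},x,U)\not\models\phi$; - $(\mathcal{X},x,U)\models\phi\land\psi$ iff $(\mathcal{X},x,U)\models\phi$ and $(\mathcal{X},x,U)\models\psi$; - $(\mathcal{X},x,U)\models K\phi$ iff for all $y\in U$, $(\mathcal{X},y,U)\models\phi$; -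 $(\mathcal{X},x,U)\models\mathsf{int}(\phi)$ iff $x\in\mathit{int}\,[\![\phi]\!]^U$, where $[\![\phi]\!]^U=\{y\in U : (\mathcal{X},y,U)\models\phi\}$ and $\mathit{int}$ denotes topological interior in $(X,\mathcal{T})$. The axiom system $\mathsf{EL}_{\mathsf{int}}$ consists of: - the axioms and rules of classical propositional logic (all instances of propositional tautologies; modus ponens); - the $\mathsf{S4}$ axioms and rules for $\mathsf{int}$: $\mathsf{int}(\phi\rightarrow\psi)\rightarrow(\mathsf{int}(\phi)\rightarrow\mathsf{int}(\psi))$, $\mathsf{int}(\phi)\rightarrow\phi$, $\mathsf{int}(\phi)\rightarrow\mathsf{int}(\mathsf{int}(\phi))$, and necessitation (from $\phi$ infer $\mathsf{int}(\phi)$); - the $\mathsf{S5}$ axioms and rules for $K$: $K(\phi\rightarrow\psi)\rightarrow(K\phi\rightarrow K\psi)$, $K\phi\rightarrow\phi$, $K\phi\rightarrow KK\phi$, $\lnot K\phi\rightarrow K\lnot K\phi$, and necessitation (from $\phi$ infer $K\phi$); - the axiom scheme (KI): $K\phi\rightarrow\mathsf{int}(\phi)$. *)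

theory Defs
  imports "HOL-Analysis.Abstract_Topology" "HOL-Library.Countable"
begin

datatype 'p fm =
    Pro 'p
  | Neg "'p fm"
  | Con "'p fm" "'p fm"
  | Know "'p fm"
  | Intr "'p fm"

abbreviation Imp :: "'p fm \<Rightarrow> 'p fm \<Rightarrow> 'p fm" (infixr \<open>\<^bold>\<longrightarrow>\<close> 25)
  where "(\<phi> \<^bold>\<longrightarrow> \<psi>) \<equiv> Neg (Con \<phi> (Neg \<psi>))"

text \<open>The underlying set of a model is \<^term>\<open>topspace T\<close>, so a model consists of a
  topology and a valuation only.\<close>

definition subset_model :: "'a topology \<Rightarrow> ('p \<Rightarrow> 'a set) \<Rightarrow> bool"
  where "subset_model T v \<longleftrightarrow> topspace T \<noteq> {} \<and> (\<forall>p. v p \<subseteq> topspace T)"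

definition scenario :: "'a topology \<Rightarrow> 'a \<Rightarrow> 'a set \<Rightarrow> bool"
  where "scenario T x U \<longleftrightarrow> x \<in> U \<and> openin T U"

primrec holds :: "'a topology \<Rightarrow> ('p \<Rightarrow> 'a set) \<Rightarrow> 'a \<Rightarrow> 'a set \<Rightarrow> 'p fm \<Rightarrow> bool"
  where
    "holds T v x U (Pro p) \<longleftrightarrow> x \<in> v p"
  | "holds T v x U (Neg \<phi>) \<longleftrightarrow> \<not> holds T v x U \<phi>"
  | "holds T v x U (Con \<phi> \<psi>) \<longleftrightarrow> holds T v x U \<phi> \<and> holds T v x U \<psi>"
  | "holds T v x U (Know \<phi>) \<longleftrightarrow> (\<forall>y\<in>U. holds T v y U \<phi>)"
  | "holds T v x U (Intr \<phi>) \<longleftrightarrow> x \<in> T interior_of {y \<in> U. holds T v y U \<phi>}"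

text \<open>Validity in the models whose underlying set is a subset of the type \<^typ>\<open>'a\<close>.
  A formula cannot quantify over types, so a statement about all models has to combine soundness
  for an arbitrary \<^typ>\<open>'a\<close> with completeness for one sufficiently large type, such as
  \<^typ>\<open>'p fm set\<close>, which contains the points of the canonical model.\<close>

definition valid :: "'a itself \<Rightarrow> 'p fm \<Rightarrow> bool"
  where "valid (_ :: 'a itself) \<phi> \<longleftrightarrow>
    (\<forall>(T :: 'a topology) v x U. subset_model T v \<longrightarrow> scenario T x U \<longrightarrow> holds T v x U \<phi>)"

text \<open>A formula is an instance of a propositional tautology iff it is true under every
  assignment of truth values to its subformulas that are primitive propositions or start
  with a modality, these being treated as atoms.\<close>

primrec bool_eval :: "('p fm \<Rightarrow> bool) \<Rightarrow> 'p fm \<Rightarrow> bool"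
  where
    "bool_eval g (Pro p) \<longleftrightarrow> g (Pro p)"
  | "bool_eval g (Neg \<phi>) \<longleftrightarrow> \<not> bool_eval g \<phi>"
  | "bool_eval g (Con \<phi> \<psi>) \<longleftrightarrow> bool_eval g \<phi> \<and> bool_eval g \<psi>"
  | "bool_eval g (Know \<phi>) \<longleftrightarrow> g (Know \<phi>)"
  | "bool_eval g (Intr \<phi>) \<longleftrightarrow> g (Intr \<phi>)"

definition tautology :: "'p fm \<Rightarrow> bool"
  where "tautology \<phi> \<longleftrightarrow> (\<forall>g. bool_eval g \<phi>)"

inductive EL_int :: "'p fm \<Rightarrow> bool"
  where
    Taut: "tautology \<phi> \<Longrightarrow> EL_int \<phi>"
  | MP: "EL_int (\<phi> \<^bold>\<longrightarrow> \<psi>) \<Longrightarrow> EL_int \<phi> \<Longrightarrow> EL_int \<psi>"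
  | Int_K: "EL_int (Intr (\<phi> \<^bold>\<longrightarrow> \<psi>) \<^bold>\<longrightarrow> Intr \<phi> \<^bold>\<longrightarrow> Intr \<psi>)"
  | Int_T: "EL_int (Intr \<phi> \<^bold>\<longrightarrow> \<phi>)"
  | Int_4: "EL_int (Intr \<phi> \<^bold>\<longrightarrow> Intr (Intr \<phi>))"
  | Int_Nec: "EL_int \<phi> \<Longrightarrow> EL_int (Intr \<phi>)"
  | Know_K: "EL_int (Know (\<phi> \<^bold>\<longrightarrow> \<psi>) \<^bold>\<longrightarrow> Know \<phi> \<^bold>\<longrightarrow> Know \<psi>)"
  | Know_T: "EL_int (Know \<phi> \<^bold>\<longrightarrow> \<phi>)"
  | Know_4: "EL_int (Know \<phi> \<^bold>\<longrightarrow> Know (Know \<phi>))"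
  | Know_5: "EL_int (Neg (Know \<phi>) \<^bold>\<longrightarrow> Know (Neg (Know \<phi>)))"
  | Know_Nec: "EL_int \<phi> \<Longrightarrow> EL_int (Know \<phi>)"
  | KI: "EL_int (Know \<phi> \<^bold>\<longrightarrow> Intr \<phi>)"

end

theory Submission
  imports Defs
begin

text \<open>
  Soundness is an induction on derivations.  The axiom (KI) is sound because, at an epistemic
  scenario \<open>(x, U)\<close>, the formula \<open>Know \<phi>\<close> makes the truth set of \<open>\<phi>\<close> within \<open>U\<close> equal to the
  open set \<open>U\<close>, of which \<open>x\<close> is then an interior point.

  Completeness uses a canonical model.  Its points are complete theories: sets of formulas that
  contain the theorems, are closed under modus ponens and decide every formula.  By Zorn's lemma
  a theory that omits a formula extends to a complete one that still omits it
  (\<open>theory_extends_to_world\<close>).  Now let \<open>\<phi>\<close> be no theorem, and let \<open>\<Gamma>\<close> be a complete theory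
  omitting it.  The space is the set \<open>cluster \<Gamma>\<close> of the complete theories that contain all that
  \<open>\<Gamma>\<close> knows; by S5 they all have the same knowledge as \<open>\<Gamma>\<close> (\<open>cluster_same_knowledge\<close>).  Its
  open sets are the sets closed under the accessibility relation of the S4 modality \<open>Intr\<close>:
  an Alexandrov topology, whose interior operator is the box of that relation
  (\<open>interior_canonical\<close>).

  The one place where the two modalities interact is that the whole cluster must be closed under
  this relation, so that it is a legitimate neighbourhood.  By (KI), whatever is known at a world
  holds at all its \<open>Intr\<close>-successors, so these lie in the same cluster
  (\<open>cluster_closed_under_intr\<close>).  At the scenarios \<open>(\<Delta>, cluster \<Gamma>)\<close> membership in \<open>\<Delta>\<close> then
  coincides with truth (\<open>truth_lemma\<close>), and \<open>\<phi>\<close> fails at \<open>(\<Gamma>, cluster \<Gamma>)\<close>.  Choosing the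
  cluster as the neighbourhood leaves just one set \<open>U\<close> to deal with in the truth lemma.
\<close>

section \<open>Soundness\<close>

text \<open>Truth at a scenario is itself an assignment of truth values to the propositional atoms.\<close>

lemma bool_eval_holds: "bool_eval (holds T v x U) \<phi> \<longleftrightarrow> holds T v x U \<phi>"
  by (induction \<phi>) simp_all

theorem soundness:
  assumes "EL_int \<phi>" "scenario T x U"
  shows "holds T v x U \<phi>"
  using assms
proof (induction arbitrary: x rule: EL_int.induct)
  case (Taut \<phi>)
  then show ?case
    by (metis bool_eval_holds tautology_def)
next
  case (Int_K \<phi> \<psi>)
  have "T interior_of {y \<in> U. holds T v y U (\<phi> \<^bold>\<longrightarrow> \<psi>)} \<inter> T interior_of {y \<in> U. holds T v y U \<phi>}
      \<subseteq> T interior_of {y \<in> U. holds T v y U \<psi>}"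
    unfolding interior_of_Int[symmetric] by (rule interior_of_mono) auto
  then show ?case by auto
next
  case (Int_T \<phi>)
  then show ?case
    using interior_of_subset[of T "{y \<in> U. holds T v y U \<phi>}"] by auto
next
  case (Int_4 \<phi>)
  \<comment> \<open>Truth sets lie inside \<open>U\<close>, so restricting the interior of one to \<open>U\<close> does not change it.\<close>
  have "{y \<in> U. holds T v y U (Intr \<phi>)} = T interior_of {y \<in> U. holds T v y U \<phi>}"
    using interior_of_subset[of T "{y \<in> U. holds T v y U \<phi>}"] by auto
  then show ?case by simp
next
  case (Int_Nec \<phi>)
  then have "{y \<in> U. holds T v y U \<phi>} = U" and "openin T U" and "x \<in> U"
    by (auto simp: scenario_def)
  then show ?case by (simp add: interior_of_openin)
next
  case (KI \<phi>)
  have "x \<in> T interior_of {y \<in> U. holds T v y U \<phi>}" if "\<forall>y\<in>U. holds T v y U \<phi>"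
  proof -
    have "{y \<in> U. holds T v y U \<phi>} = U"
      using that by auto
    with KI show ?thesis
      by (simp add: scenario_def interior_of_openin)
  qed
  then show ?case by auto
qed (auto simp: scenario_def)

section \<open>Theories and worlds\<close>

definition theory_set :: "'p fm set \<Rightarrow> bool"
  where "theory_set \<Gamma> \<longleftrightarrow>
    Collect EL_int \<subseteq> \<Gamma> \<and> (\<forall>\<phi> \<psi>. (\<phi> \<^bold>\<longrightarrow> \<psi>) \<in> \<Gamma> \<longrightarrow> \<phi> \<in> \<Gamma> \<longrightarrow> \<psi> \<in> \<Gamma>)"

definition world :: "'p fm set \<Rightarrow> bool"
  where "world \<Gamma> \<longleftrightarrow> theory_set \<Gamma> \<and> (\<forall>\<phi>. Neg \<phi> \<in> \<Gamma> \<longleftrightarrow> \<phi> \<notin> \<Gamma>)"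

lemma theory_set_theorem: "theory_set \<Gamma> \<Longrightarrow> EL_int \<phi> \<Longrightarrow> \<phi> \<in> \<Gamma>"
  by (auto simp: theory_set_def)

lemma theory_set_mp: "theory_set \<Gamma> \<Longrightarrow> (\<phi> \<^bold>\<longrightarrow> \<psi>) \<in> \<Gamma> \<Longrightarrow> \<phi> \<in> \<Gamma> \<Longrightarrow> \<psi> \<in> \<Gamma>"
  unfolding theory_set_def by blast

lemma theory_set_imp: "theory_set \<Gamma> \<Longrightarrow> EL_int (\<phi> \<^bold>\<longrightarrow> \<psi>) \<Longrightarrow> \<phi> \<in> \<Gamma> \<Longrightarrow> \<psi> \<in> \<Gamma>"
  by (blast intro: theory_set_mp theory_set_theorem)

lemma theory_set_imp2:
  "theory_set \<Gamma> \<Longrightarrow> EL_int (\<phi> \<^bold>\<longrightarrow> \<psi> \<^bold>\<longrightarrow> \<chi>) \<Longrightarrow> \<phi> \<in> \<Gamma> \<Longrightarrow> \<psi> \<in> \<Gamma> \<Longrightarrow> \<chi> \<in> \<Gamma>"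
  by (blast intro: theory_set_mp theory_set_imp)

lemma theory_set_theorems: "theory_set (Collect EL_int)"
  by (auto simp: theory_set_def intro: EL_int.MP)

lemma theory_set_chain_Union:
  assumes "subset.chain A C" "C \<noteq> {}" "\<And>\<Gamma>. \<Gamma> \<in> A \<Longrightarrow> theory_set \<Gamma>"
  shows "theory_set (\<Union>C)"
  unfolding theory_set_def
proof (intro conjI allI impI)
  have C: "\<And>\<Gamma>. \<Gamma> \<in> C \<Longrightarrow> theory_set \<Gamma>"
    using assms by (auto simp: subset.chain_def)
  with \<open>C \<noteq> {}\<close> show "Collect EL_int \<subseteq> \<Union>C"
    by (auto simp: theory_set_def)
  fix \<phi> \<psi> :: "'a fm"
  assume "(\<phi> \<^bold>\<longrightarrow> \<psi>) \<in> \<Union>C" "\<phi> \<in> \<Union>C"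
  then obtain \<Gamma> \<Delta> where "\<Gamma> \<in> C" "(\<phi> \<^bold>\<longrightarrow> \<psi>) \<in> \<Gamma>" "\<Delta> \<in> C" "\<phi> \<in> \<Delta>"
    by blast
  moreover from this have "\<Gamma> \<subseteq> \<Delta> \<or> \<Delta> \<subseteq> \<Gamma>"
    using assms(1) by (auto simp: subset_chain_def)
  ultimately show "\<psi> \<in> \<Union>C"
    using C by (blast intro: theory_set_mp)
qed

text \<open>The set of consequences of \<open>\<psi>\<close> over \<open>\<Gamma>\<close>, the theory generated by \<open>\<Gamma> \<union> {\<psi>}\<close>.
  Describing it by implications replaces a notion of derivation from hypotheses and the
  deduction theorem for it.\<close>

lemma theory_set_consequences:
  assumes "theory_set \<Gamma>"
  shows "theory_set {\<chi>. (\<psi> \<^bold>\<longrightarrow> \<chi>) \<in> \<Gamma>}" and "\<Gamma> \<subseteq> {\<chi>. (\<psi> \<^bold>\<longrightarrow> \<chi>) \<in> \<Gamma>}"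
    and "\<psi> \<in> {\<chi>. (\<psi> \<^bold>\<longrightarrow> \<chi>) \<in> \<Gamma>}"
proof -
  have taut_K: "EL_int (\<chi> \<^bold>\<longrightarrow> \<psi> \<^bold>\<longrightarrow> \<chi>)" for \<chi>
    by (rule Taut) (simp add: tautology_def)
  have taut_S: "EL_int ((\<psi> \<^bold>\<longrightarrow> \<alpha> \<^bold>\<longrightarrow> \<beta>) \<^bold>\<longrightarrow> (\<psi> \<^bold>\<longrightarrow> \<alpha>) \<^bold>\<longrightarrow> (\<psi> \<^bold>\<longrightarrow> \<beta>))" for \<alpha> \<beta>
    by (rule Taut) (auto simp: tautology_def)
  have taut_I: "EL_int (\<psi> \<^bold>\<longrightarrow> \<psi>)"
    by (rule Taut) (simp add: tautology_def)
  show sub: "\<Gamma> \<subseteq> {\<chi>. (\<psi> \<^bold>\<longrightarrow> \<chi>) \<in> \<Gamma>}"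
    using theory_set_imp[OF assms taut_K] by blast
  show "theory_set {\<chi>. (\<psi> \<^bold>\<longrightarrow> \<chi>) \<in> \<Gamma>}"
    unfolding theory_set_def mem_Collect_eq
    using sub theory_set_theorem[OF assms] theory_set_imp2[OF assms taut_S] by blast
  show "\<psi> \<in> {\<chi>. (\<psi> \<^bold>\<longrightarrow> \<chi>) \<in> \<Gamma>}"
    using theory_set_theorem[OF assms taut_I] by blast
qed

text \<open>Lindenbaum's lemma.  A theory maximal among those omitting \<open>\<phi>\<close> decides every formula:
  if it contained neither \<open>\<psi>\<close> nor \<open>Neg \<psi>\<close>, both would have to imply \<open>\<phi>\<close> over it.\<close>

lemma theory_extends_to_world:
  assumes "theory_set \<Gamma>" "\<phi> \<notin> \<Gamma>"
  obtains \<Delta> where "world \<Delta>" "\<Gamma> \<subseteq> \<Delta>" "\<phi> \<notin> \<Delta>"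
proof -
  define A where "A = {\<Delta>. theory_set \<Delta> \<and> \<Gamma> \<subseteq> \<Delta> \<and> \<phi> \<notin> \<Delta>}"
  have "\<Gamma> \<in> A"
    using assms by (simp add: A_def)
  moreover have "\<Union>C \<in> A" if "C \<noteq> {}" "subset.chain A C" for C
  proof -
    have "C \<subseteq> A"
      using that by (simp add: subset.chain_def)
    moreover have "theory_set (\<Union>C)"
      using that by (intro theory_set_chain_Union) (auto simp: A_def)
    ultimately show ?thesis
      using that(1) unfolding A_def by blast
  qed
  ultimately obtain \<Delta> where "\<Delta> \<in> A" and max: "\<And>\<Theta>. \<Theta> \<in> A \<Longrightarrow> \<Delta> \<subseteq> \<Theta> \<Longrightarrow> \<Theta> = \<Delta>"
    using subset_Zorn_nonempty[of A] by blast
  then have \<Delta>: "theory_set \<Delta>" "\<Gamma> \<subseteq> \<Delta>" "\<phi> \<notin> \<Delta>"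
    by (auto simp: A_def)
  have omitted: "(\<psi> \<^bold>\<longrightarrow> \<phi>) \<in> \<Delta>" if "\<psi> \<notin> \<Delta>" for \<psi>
    using max[of "{\<chi>. (\<psi> \<^bold>\<longrightarrow> \<chi>) \<in> \<Delta>}"] theory_set_consequences[OF \<Delta>(1), of \<psi>] \<Delta> that
    unfolding A_def by blast
  have cases: "EL_int ((\<psi> \<^bold>\<longrightarrow> \<phi>) \<^bold>\<longrightarrow> (Neg \<psi> \<^bold>\<longrightarrow> \<phi>) \<^bold>\<longrightarrow> \<phi>)" for \<psi>
    by (rule Taut) (auto simp: tautology_def)
  have explosion: "EL_int (\<psi> \<^bold>\<longrightarrow> Neg \<psi> \<^bold>\<longrightarrow> \<phi>)" for \<psi>
    by (rule Taut) (auto simp: tautology_def)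
  have "Neg \<psi> \<in> \<Delta> \<longleftrightarrow> \<psi> \<notin> \<Delta>" for \<psi>
    using theory_set_imp2[OF \<Delta>(1) cases] theory_set_imp2[OF \<Delta>(1) explosion] omitted \<Delta>(3)
    by blast
  with \<Delta> have "world \<Delta>"
    by (simp add: world_def)
  with \<Delta> that show thesis by blast
qed

lemma world_theory_set: "world \<Gamma> \<Longrightarrow> theory_set \<Gamma>"
  by (simp add: world_def)

lemma world_Neg: "world \<Gamma> \<Longrightarrow> Neg \<phi> \<in> \<Gamma> \<longleftrightarrow> \<phi> \<notin> \<Gamma>"
  by (simp add: world_def)

lemmas world_imp = theory_set_imp[OF world_theory_set]

lemma world_Con:
  assumes "world \<Gamma>"
  shows "Con \<phi> \<psi> \<in> \<Gamma> \<longleftrightarrow> \<phi> \<in> \<Gamma> \<and> \<psi> \<in> \<Gamma>"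
proof -
  have "EL_int (Con \<phi> \<psi> \<^bold>\<longrightarrow> \<phi>)" "EL_int (Con \<phi> \<psi> \<^bold>\<longrightarrow> \<psi>)" "EL_int (\<phi> \<^bold>\<longrightarrow> \<psi> \<^bold>\<longrightarrow> Con \<phi> \<psi>)"
    by (rule Taut, auto simp: tautology_def)+
  then show ?thesis
    using theory_set_imp2[OF world_theory_set] world_imp assms by blast
qed

section \<open>Accessibility\<close>

text \<open>The accessibility relation of a modality \<open>f\<close> relates \<open>\<Gamma>\<close> to the worlds that include
  \<open>unbox f \<Gamma>\<close>.\<close>

definition unbox :: "('p fm \<Rightarrow> 'p fm) \<Rightarrow> 'p fm set \<Rightarrow> 'p fm set"
  where "unbox f \<Gamma> = {\<phi>. f \<phi> \<in> \<Gamma>}"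

text \<open>Normality of \<open>f\<close> says precisely that unboxing preserves theories, so that Lindenbaum's
  lemma supplies the witnesses needed for \<open>f\<close>.\<close>

lemma world_omitting_unboxed:
  assumes K: "\<And>\<phi> \<psi>. EL_int (f (\<phi> \<^bold>\<longrightarrow> \<psi>) \<^bold>\<longrightarrow> f \<phi> \<^bold>\<longrightarrow> f \<psi>)"
    and Nec: "\<And>\<phi>. EL_int \<phi> \<Longrightarrow> EL_int (f \<phi>)"
    and "world \<Gamma>" "f \<psi> \<notin> \<Gamma>"
  obtains \<Delta> where "world \<Delta>" "unbox f \<Gamma> \<subseteq> \<Delta>" "\<psi> \<notin> \<Delta>"
proof -
  have "theory_set \<Gamma>"
    using \<open>world \<Gamma>\<close> by (rule world_theory_set)
  then have "theory_set (unbox f \<Gamma>)"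
    unfolding theory_set_def[of "unbox f \<Gamma>"] unfolding unbox_def mem_Collect_eq
    using theory_set_theorem Nec theory_set_imp2[OF _ K] by blast
  moreover have "\<psi> \<notin> unbox f \<Gamma>"
    using \<open>f \<psi> \<notin> \<Gamma>\<close> by (simp add: unbox_def)
  ultimately show thesis
    using theory_extends_to_world that by blast
qed

lemma unbox_Intr_subset: "world \<Gamma> \<Longrightarrow> unbox Intr \<Gamma> \<subseteq> \<Gamma>"
  using world_imp[OF _ Int_T] by (auto simp: unbox_def)

lemma unbox_Intr_trans:
  assumes "world \<Gamma>" "unbox Intr \<Gamma> \<subseteq> \<Delta>"
  shows "unbox Intr \<Gamma> \<subseteq> unbox Intr \<Delta>"
  using world_imp[OF assms(1) Int_4] assms(2) by (auto simp: unbox_def)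

definition cluster :: "'p fm set \<Rightarrow> 'p fm set set"
  where "cluster \<Gamma> = {\<Delta>. world \<Delta> \<and> unbox Know \<Gamma> \<subseteq> \<Delta>}"

lemma cluster_world: "\<Delta> \<in> cluster \<Gamma> \<Longrightarrow> world \<Delta>"
  by (simp add: cluster_def)

lemma cluster_refl: "world \<Gamma> \<Longrightarrow> \<Gamma> \<in> cluster \<Gamma>"
  using world_imp[OF _ Know_T] by (auto simp: cluster_def unbox_def)

text \<open>Positive introspection makes the knowledge of \<open>\<Gamma>\<close> known throughout its cluster;
  negative introspection makes its ignorance hold throughout.\<close>

lemma cluster_same_knowledge:
  assumes "world \<Gamma>" "\<Delta> \<in> cluster \<Gamma>"
  shows "unbox Know \<Delta> = unbox Know \<Gamma>"
proof -
  have \<Delta>: "world \<Delta>" "\<And>\<phi>. Know \<phi> \<in> \<Gamma> \<Longrightarrow> \<phi> \<in> \<Delta>"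
    using assms(2) by (auto simp: cluster_def unbox_def)
  have "Know \<phi> \<in> \<Delta> \<longleftrightarrow> Know \<phi> \<in> \<Gamma>" for \<phi>
    using world_imp[OF assms(1) Know_4, of \<phi>] world_imp[OF assms(1) Know_5, of \<phi>]
      world_Neg[OF assms(1), of "Know \<phi>"] world_Neg[OF \<Delta>(1), of "Know \<phi>"] \<Delta>(2)
    by blast
  then show ?thesis by (simp add: unbox_def)
qed

text \<open>This is what (KI) is for.\<close>

lemma cluster_closed_under_intr:
  assumes "world \<Gamma>" "\<Delta> \<in> cluster \<Gamma>" "world \<Theta>" "unbox Intr \<Delta> \<subseteq> \<Theta>"
  shows "\<Theta> \<in> cluster \<Gamma>"
proof -
  have "unbox Know \<Gamma> = unbox Know \<Delta>"
    using cluster_same_knowledge assms by blast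
  also have "\<dots> \<subseteq> unbox Intr \<Delta>"
    using world_imp[OF cluster_world[OF assms(2)] KI] by (auto simp: unbox_def)
  finally show ?thesis
    using assms by (auto simp: cluster_def)
qed

section \<open>The canonical model\<close>

definition canonical :: "'p fm set \<Rightarrow> 'p fm set topology"
  where "canonical \<Gamma> = topology (\<lambda>W. W \<subseteq> cluster \<Gamma> \<and>
    (\<forall>\<Delta>\<in>W. \<forall>\<Theta>. world \<Theta> \<longrightarrow> unbox Intr \<Delta> \<subseteq> \<Theta> \<longrightarrow> \<Theta> \<in> W))"

definition canonical_val :: "'p fm set \<Rightarrow> 'p \<Rightarrow> 'p fm set set"
  where "canonical_val \<Gamma> p = {\<Delta> \<in> cluster \<Gamma>. Pro p \<in> \<Delta>}"

lemma openin_canonical: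
  "openin (canonical \<Gamma>) W \<longleftrightarrow> W \<subseteq> cluster \<Gamma> \<and>
    (\<forall>\<Delta>\<in>W. \<forall>\<Theta>. world \<Theta> \<longrightarrow> unbox Intr \<Delta> \<subseteq> \<Theta> \<longrightarrow> \<Theta> \<in> W)"
proof -
  have "istopology (\<lambda>W. W \<subseteq> cluster \<Gamma> \<and>
    (\<forall>\<Delta>\<in>W. \<forall>\<Theta>. world \<Theta> \<longrightarrow> unbox Intr \<Delta> \<subseteq> \<Theta> \<longrightarrow> \<Theta> \<in> W))"
    unfolding istopology_def by blast
  then show ?thesis
    unfolding canonical_def by (simp add: topology_inverse')
qed

lemma openin_canonical_cluster: "world \<Gamma> \<Longrightarrow> openin (canonical \<Gamma>) (cluster \<Gamma>)"
  using cluster_closed_under_intr by (auto simp: openin_canonical)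

lemma topspace_canonical: "world \<Gamma> \<Longrightarrow> topspace (canonical \<Gamma>) = cluster \<Gamma>"
  using openin_subset[OF openin_canonical_cluster]
    openin_canonical[of \<Gamma> "topspace (canonical \<Gamma>)"]
  by blast

text \<open>The successors of \<open>\<Delta>\<close> form its least open neighbourhood, by the two S4 axioms.\<close>

lemma interior_canonical:
  assumes "world \<Gamma>" "\<Delta> \<in> cluster \<Gamma>"
  shows "\<Delta> \<in> canonical \<Gamma> interior_of W \<longleftrightarrow>
    (\<forall>\<Theta>. world \<Theta> \<longrightarrow> unbox Intr \<Delta> \<subseteq> \<Theta> \<longrightarrow> \<Theta> \<in> W)"
proof
  assume "\<Delta> \<in> canonical \<Gamma> interior_of W"
  then show "\<forall>\<Theta>. world \<Theta> \<longrightarrow> unbox Intr \<Delta> \<subseteq> \<Theta> \<longrightarrow> \<Theta> \<in> W"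
    unfolding interior_of_def openin_canonical by blast
next
  assume W: "\<forall>\<Theta>. world \<Theta> \<longrightarrow> unbox Intr \<Delta> \<subseteq> \<Theta> \<longrightarrow> \<Theta> \<in> W"
  define N where "N = {\<Theta>. world \<Theta> \<and> unbox Intr \<Delta> \<subseteq> \<Theta>}"
  have "world \<Delta>"
    using assms(2) by (rule cluster_world)
  have "openin (canonical \<Gamma>) N"
    unfolding openin_canonical N_def
    using cluster_closed_under_intr[OF assms] unbox_Intr_trans[OF \<open>world \<Delta>\<close>] by blast
  moreover have "\<Delta> \<in> N"
    using \<open>world \<Delta>\<close> unbox_Intr_subset by (simp add: N_def)
  moreover have "N \<subseteq> W"
    using W by (auto simp: N_def)
  ultimately show "\<Delta> \<in> canonical \<Gamma> interior_of W"
    unfolding interior_of_def by blast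
qed

text \<open>In both modal cases Lindenbaum's lemma yields, when a boxed formula is missing from
  \<open>\<Delta>\<close>, an accessible world missing the formula.\<close>

lemma truth_lemma:
  assumes "world \<Gamma>" "\<Delta> \<in> cluster \<Gamma>"
  shows "holds (canonical \<Gamma>) (canonical_val \<Gamma>) \<Delta> (cluster \<Gamma>) \<phi> \<longleftrightarrow> \<phi> \<in> \<Delta>"
  using assms(2)
proof (induction \<phi> arbitrary: \<Delta>)
  case (Pro p)
  then show ?case by (simp add: canonical_val_def)
next
  case (Neg \<phi>)
  then show ?case by (simp add: world_Neg cluster_world)
next
  case (Con \<phi> \<psi>)
  then show ?case by (simp add: world_Con cluster_world)
next
  case (Know \<phi>)
  have "(\<forall>\<Theta>\<in>cluster \<Gamma>. \<phi> \<in> \<Theta>) \<longleftrightarrow> Know \<phi> \<in> \<Gamma>"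
    using world_omitting_unboxed[of Know, OF Know_K Know_Nec assms(1), of \<phi>]
    by (auto simp: cluster_def unbox_def)
  also have "\<dots> \<longleftrightarrow> Know \<phi> \<in> \<Delta>"
    using cluster_same_knowledge[OF assms(1) Know.prems] by (auto simp: unbox_def)
  finally show ?case
    using Know.IH by simp
next
  case (Intr \<phi>)
  have "world \<Delta>"
    using Intr.prems by (rule cluster_world)
  have "{\<Theta> \<in> cluster \<Gamma>. holds (canonical \<Gamma>) (canonical_val \<Gamma>) \<Theta> (cluster \<Gamma>) \<phi>} =
      {\<Theta> \<in> cluster \<Gamma>. \<phi> \<in> \<Theta>}"
    using Intr.IH by blast
  then have "holds (canonical \<Gamma>) (canonical_val \<Gamma>) \<Delta> (cluster \<Gamma>) (Intr \<phi>) \<longleftrightarrow>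
      (\<forall>\<Theta>. world \<Theta> \<longrightarrow> unbox Intr \<Delta> \<subseteq> \<Theta> \<longrightarrow> \<phi> \<in> \<Theta>)"
    using cluster_closed_under_intr[OF assms(1) Intr.prems]
    by (auto simp: interior_canonical[OF assms(1) Intr.prems])
  also have "\<dots> \<longleftrightarrow> Intr \<phi> \<in> \<Delta>"
    using world_omitting_unboxed[of Intr, OF Int_K Int_Nec \<open>world \<Delta>\<close>, of \<phi>]
    by (auto simp: unbox_def)
  finally show ?case .
qed

theorem completeness:
  fixes \<phi> :: "'p fm"
  assumes "valid TYPE('p fm set) \<phi>"
  shows "EL_int \<phi>"
proof (rule ccontr)
  assume "\<not> EL_int \<phi>"
  then obtain \<Gamma> where \<Gamma>: "world \<Gamma>" "\<phi> \<notin> \<Gamma>"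
    using theory_extends_to_world[OF theory_set_theorems, of \<phi>] by auto
  have "subset_model (canonical \<Gamma>) (canonical_val \<Gamma>)"
    using cluster_refl[OF \<Gamma>(1)]
    by (auto simp: subset_model_def topspace_canonical[OF \<Gamma>(1)] canonical_val_def)
  moreover have "scenario (canonical \<Gamma>) \<Gamma> (cluster \<Gamma>)"
    using openin_canonical_cluster[OF \<Gamma>(1)] cluster_refl[OF \<Gamma>(1)] by (simp add: scenario_def)
  ultimately have "holds (canonical \<Gamma>) (canonical_val \<Gamma>) \<Gamma> (cluster \<Gamma>) \<phi>"
    using assms by (simp add: valid_def)
  then show False
    using truth_lemma[OF \<Gamma>(1) cluster_refl[OF \<Gamma>(1)]] \<Gamma>(2) by blast
qed

theorem theorem1:
  fixes \<phi> :: "('p :: countable) fm"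
  shows "(EL_int \<phi> \<longleftrightarrow> valid TYPE('p fm set) \<phi>) \<and> (EL_int \<phi> \<longrightarrow> valid TYPE('a) \<phi>)"
proof -
  have "EL_int \<phi> \<Longrightarrow> valid TYPE('p fm set) \<phi>"
    by (simp add: valid_def soundness)
  moreover have "EL_int \<phi> \<Longrightarrow> valid TYPE('a) \<phi>"
    by (simp add: valid_def soundness)
  ultimately show ?thesis
    using completeness by blast
qed

end
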